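(* Let $S=\{(1/(1-z),\,z/(1-z))\}$ and let $B$ be the Bell subgroup of the Riordan group (over real coefficients). Then \[ C_B(S)=\left\{\left(\frac{1}{1-rz},\,\frac{z}{1-rz}\right): r\in\mathbb{R}\right\}. \]
   Context: Here $\mathcal{F}=\mathbb{R}[[z]]$ and $\mathcal{F}_r$ is the set of formal power series of order $r$ (least index of a nonzero coefficient equals $r$). A (proper) Riordan array is a pair $(d(z),h(z))$ with $d\in\mathcal{F}_0$, $h\in\mathcal{F}_1$, identified with the infinite lower triangular matrix whose $(n,k)$ entry is $[z^n]d(z)h(z)^k$; the Riordan group is the set of such arrays with product $(d_1,h_1)(d_2,h_2)=(d_1\cdot d_2(h_1),\,h_2(h_1))$ and identity $(1,z)$. The Bell subgroup is $B=\{(d(z),zd(z)): d\in\mathcal{F}_0\}$. For a subset $S$ of a group $H$, $C_H(S)=\{g\in H: gs=sg \text{ for all } s\in S\}$. *)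

theory Defs
  imports "HOL-Computational_Algebra.Formal_Power_Series" "HOL-Algebra.Group"
begin

unbundle fps_syntax

(* The library sets subdegree 0 = 0, so the zero series has to be excluded explicitly. *)
definition fps_of_order :: "nat \<Rightarrow> real fps set" where
  "fps_of_order r = {f. f \<noteq> 0 \<and> subdegree f = r}"

(* The array (d, h) stands for the lower triangular matrix with (n, k) entry (d * h ^ k) $ n;
   f oo g is the composition f(g(z)). *)
definition riordan_group :: "(real fps \<times> real fps) monoid" where
  "riordan_group =
     \<lparr>carrier = fps_of_order 0 \<times> fps_of_order 1,
      mult = (\<lambda>(d1, h1) (d2, h2). (d1 * (d2 oo h1), h2 oo h1)),
      one = (1, fps_X)\<rparr>"

definition bell_subgroup :: "(real fps \<times> real fps) set" where
  "bell_subgroup = {(d, fps_X * d) | d. d \<in> fps_of_order 0}"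

definition centralizer :: "('a, 'b) monoid_scheme \<Rightarrow> 'a set \<Rightarrow> 'a set" where
  "centralizer H S = {g \<in> carrier H. \<forall>s\<in>S. g \<otimes>\<^bsub>H\<^esub> s = s \<otimes>\<^bsub>H\<^esub> g}"

lemma fps_of_order_0_iff: "f \<in> fps_of_order 0 \<longleftrightarrow> f $ 0 \<noteq> 0"
  by (auto simp: fps_of_order_def subdegree_eq_0_iff)

lemma fps_of_order_1_iff: "f \<in> fps_of_order 1 \<longleftrightarrow> f $ 0 = 0 \<and> f $ 1 \<noteq> 0"
proof
  assume "f \<in> fps_of_order 1"
  then have "f \<noteq> 0" "subdegree f = 1" by (auto simp: fps_of_order_def)
  then show "f $ 0 = 0 \<and> f $ 1 \<noteq> 0"
    by (metis nth_less_subdegree_zero nth_subdegree_nonzero zero_less_one)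
next
  assume "f $ 0 = 0 \<and> f $ 1 \<noteq> 0"
  then show "f \<in> fps_of_order 1"
    by (auto simp: fps_of_order_def intro!: subdegreeI)
qed

lemma fps_compose_nth_1: "(f oo g) $ 1 = f $ 1 * g $ 1" for f g :: "real fps"
  by (simp add: fps_compose_nth)

lemma riordan_carrier_iff:
  "(d, h) \<in> carrier riordan_group \<longleftrightarrow> d $ 0 \<noteq> 0 \<and> h $ 0 = 0 \<and> h $ 1 \<noteq> 0"
  by (simp add: riordan_group_def fps_of_order_0_iff fps_of_order_1_iff del: One_nat_def)

lemma riordan_mult:
  "(d1, h1) \<otimes>\<^bsub>riordan_group\<^esub> (d2, h2) = (d1 * (d2 oo h1), h2 oo h1)"
  by (simp add: riordan_group_def)

lemma riordan_one: "\<one>\<^bsub>riordan_group\<^esub> = (1, fps_X)"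
  by (simp add: riordan_group_def)

lemma riordan_inverse:
  assumes "(d, h) \<in> carrier riordan_group"
  defines "k \<equiv> fps_inv h"
  shows "(inverse (d oo k), k) \<in> carrier riordan_group"
    and "(inverse (d oo k), k) \<otimes>\<^bsub>riordan_group\<^esub> (d, h) = \<one>\<^bsub>riordan_group\<^esub>"
proof -
  have d0: "d $ 0 \<noteq> 0" and h0: "h $ 0 = 0" and h1: "h $ 1 \<noteq> 0"
    using assms(1) by (auto simp: riordan_carrier_iff simp del: One_nat_def)
  have k0: "k $ 0 = 0" and k1: "k $ 1 \<noteq> 0"
    using h1 by (simp_all add: k_def fps_inv_def)
  have hk: "h oo k = fps_X"
    unfolding k_def by (rule fps_inv_right[OF h0 h1])
  show "(inverse (d oo k), k) \<in> carrier riordan_group"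
    using d0 k0 k1 by (simp add: riordan_carrier_iff)
  show "(inverse (d oo k), k) \<otimes>\<^bsub>riordan_group\<^esub> (d, h) = \<one>\<^bsub>riordan_group\<^esub>"
    using d0 by (simp add: riordan_mult riordan_one hk inverse_mult_eq_1)
qed

lemma group_riordan_group: "group riordan_group"
proof (rule groupI)
  show "x \<otimes>\<^bsub>riordan_group\<^esub> y \<in> carrier riordan_group"
    if "x \<in> carrier riordan_group" "y \<in> carrier riordan_group" for x y
    using that
    by (cases x; cases y)
      (simp add: riordan_carrier_iff riordan_mult fps_compose_nth_1 del: One_nat_def)
  show "\<one>\<^bsub>riordan_group\<^esub> \<in> carrier riordan_group"
    by (simp add: riordan_one riordan_carrier_iff)
  show "x \<otimes>\<^bsub>riordan_group\<^esub> y \<otimes>\<^bsub>riordan_group\<^esub> z =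
      x \<otimes>\<^bsub>riordan_group\<^esub> (y \<otimes>\<^bsub>riordan_group\<^esub> z)"
    if "x \<in> carrier riordan_group" "y \<in> carrier riordan_group" "z \<in> carrier riordan_group"
    for x y z
    using that
    by (cases x; cases y; cases z)
      (simp add: riordan_carrier_iff riordan_mult fps_compose_mult_distrib
        fps_compose_assoc mult.assoc del: One_nat_def)
  show "\<one>\<^bsub>riordan_group\<^esub> \<otimes>\<^bsub>riordan_group\<^esub> x = x" if "x \<in> carrier riordan_group" for x
    by (cases x) (simp add: riordan_one riordan_mult)
  show "\<exists>y\<in>carrier riordan_group. y \<otimes>\<^bsub>riordan_group\<^esub> x = \<one>\<^bsub>riordan_group\<^esub>"
    if "x \<in> carrier riordan_group" for x
    using that riordan_inverse by (cases x) blast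
qed

lemma subgroup_bell_subgroup: "subgroup bell_subgroup riordan_group"
proof (rule group.subgroupI[OF group_riordan_group])
  show sub: "bell_subgroup \<subseteq> carrier riordan_group"
    by (auto simp: bell_subgroup_def riordan_carrier_iff fps_of_order_0_iff)
  have "(1, fps_X * 1) \<in> bell_subgroup"
    unfolding bell_subgroup_def by (auto simp: fps_of_order_0_iff)
  then show "bell_subgroup \<noteq> {}" by blast
  show "x \<otimes>\<^bsub>riordan_group\<^esub> y \<in> bell_subgroup"
    if "x \<in> bell_subgroup" "y \<in> bell_subgroup" for x y
    using that
    by (auto simp: bell_subgroup_def riordan_mult fps_of_order_0_iff fps_compose_mult_distrib
        mult.assoc)
  show "inv\<^bsub>riordan_group\<^esub> x \<in> bell_subgroup" if x: "x \<in> bell_subgroup" for x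
  proof -
    obtain d where d: "x = (d, fps_X * d)" "d $ 0 \<noteq> 0"
      using x by (auto simp: bell_subgroup_def fps_of_order_0_iff)
    define k where "k = fps_inv (fps_X * d)"
    have car: "(d, fps_X * d) \<in> carrier riordan_group"
      using sub x d by blast
    note I = riordan_inverse[OF car, folded k_def]
    have inv: "inv\<^bsub>riordan_group\<^esub> x = (inverse (d oo k), k)"
      using group.inv_equality[OF group_riordan_group I(2) car I(1)] d by simp
    have k0: "k $ 0 = 0" using I(1) by (simp add: riordan_carrier_iff)
    have "(fps_X * d) oo k = fps_X"
      using I(2) by (simp add: riordan_mult riordan_one)
    then have "k * (d oo k) = fps_X"
      by (simp add: fps_compose_mult_distrib k0)
    then have "k * ((d oo k) * inverse (d oo k)) = fps_X * inverse (d oo k)"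
      by (metis mult.assoc)
    then have "k = fps_X * inverse (d oo k)"
      using d(2) by (simp add: inverse_mult_eq_1')
    then show ?thesis
      unfolding inv bell_subgroup_def using d(2) by (auto simp: fps_of_order_0_iff)
  qed
qed

end

theory Submission
  imports Defs
begin

text \<open>
  Put \<open>p = z / (1 - z)\<close>. For a Bell array \<open>(d, z d)\<close> the commutation relation becomes affine in
  \<open>e = 1 / d\<close>: it reads \<open>(1 - z) e(p) = e - z\<close>. The series \<open>1 - r z\<close> solve this equation. The
  difference of a solution and the \<open>1 - r z\<close> that agrees with it up to order one solves
  \<open>(1 - z) f(p) = f\<close>; if \<open>f\<close> has order \<open>m\<close> and leading coefficient \<open>c\<close>, comparing
  coefficients of \<open>z^(m+1)\<close> gives \<open>(m - 1) c = 0\<close>, which is impossible for \<open>m \<ge> 2\<close>.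
\<close>

lemma fps_power_nth_1:
  fixes f :: "'a::comm_semiring_1 fps"
  assumes "f $ 0 = 1"
  shows "(f ^ k) $ 1 = of_nat k * f $ 1"
  using assms by (induction k) (simp_all add: fps_mult_nth_1 fps_power_zeroth algebra_simps)

lemma fps_inverse_eq_iff:
  fixes f g :: "'a::field fps"
  assumes "f $ 0 \<noteq> 0" "g $ 0 \<noteq> 0"
  shows "inverse f = inverse g \<longleftrightarrow> f = g"
  using fps_inverse_idempotent[OF assms(1)] fps_inverse_idempotent[OF assms(2)] by metis

lemma one_minus_fps_X_inverse:
  "(1 - fps_X) * inverse (1 - fps_X :: real fps) = 1"
  by (rule inverse_mult_eq_1') simp

lemma fixed_point_eq_0:
  fixes f :: "real fps"
  assumes eq: "(1 - fps_X) * (f oo (fps_X * inverse (1 - fps_X))) = f"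
    and f0: "f $ 0 = 0" and f1: "f $ 1 = 0"
  shows "f = 0"
proof (rule ccontr)
  assume "f \<noteq> 0"
  define q where "q = inverse (1 - fps_X :: real fps)"
  define p where "p = fps_X * q"
  define m where "m = subdegree f"
  define g where "g = unit_factor f"
  have q: "(1 - fps_X) * q = 1"
    unfolding q_def by (rule one_minus_fps_X_inverse)
  have q0: "q $ 0 = 1" by (simp add: q_def)
  have q1: "q $ 1 = 1" using arg_cong[OF q, of "\<lambda>f. f $ 1"]
    by (simp add: fps_mult_nth_1 q0)
  have p0: "p $ 0 = 0" and p1: "p $ 1 = 1"
    by (simp_all add: p_def q0)
  have g0: "g $ 0 \<noteq> 0"
    using \<open>f \<noteq> 0\<close> by (simp add: g_def)
  have "f $ m \<noteq> 0" using \<open>f \<noteq> 0\<close> by (simp add: m_def)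
  then have "m \<noteq> 0" "m \<noteq> 1" using f0 f1 by metis+
  then obtain k where m: "m = Suc k" and k: "k \<noteq> 0"
    by (cases m) auto
  have f: "f = fps_X ^ m * g"
    by (simp add: m_def g_def mult.commute flip: subdegree_decompose')
  have "f oo p = p ^ m * (g oo p)"
    unfolding f by (simp add: fps_compose_mult_distrib fps_X_power_compose p0)
  \<comment> \<open>Here \<open>p ^ m\<close> is \<open>fps_X ^ m * q ^ Suc k\<close>; the factor
    \<open>1 - fps_X\<close> absorbs one of the \<open>q\<close>, so the exponent left over is
    \<open>k\<close>, that is \<open>m - 1\<close>.\<close>
  then have "fps_X ^ m * (((1 - fps_X) * q) * q ^ k * (g oo p)) = fps_X ^ m * g"
    using eq f by (simp add: p_def q_def m power_mult_distrib mult_ac)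
  then have "q ^ k * (g oo p) = g"
    unfolding q by simp
  then have "(q ^ k * (g oo p)) $ 1 = g $ 1" by simp
  \<comment> \<open>Since \<open>p\<close> begins with \<open>z\<close>, \<open>g oo p\<close> and
    \<open>g\<close> agree up to order one; their linear coefficients cancel and only the
    contribution of \<open>q ^ k\<close> remains.\<close>
  then have "real k * g $ 0 = 0"
    using fps_power_nth_1[OF q0, of k] fps_compose_nth_1[of g p]
    by (simp add: fps_mult_nth_1 fps_power_zeroth q0 q1 p1 del: One_nat_def)
  with k g0 show False by simp
qed

lemma reciprocal_equation_iff:
  fixes e :: "real fps"
  shows "(1 - fps_X) * (e oo (fps_X * inverse (1 - fps_X))) = e - fps_X
    \<longleftrightarrow> (\<exists>r. e = 1 - fps_const r * fps_X)"
    (is "?E e \<longleftrightarrow> _")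
proof
  let ?p = "fps_X * inverse (1 - fps_X) :: real fps"
  have lin: "(1 - fps_X) * ((1 - fps_const r * fps_X) oo ?p) = 1 - fps_const r * fps_X - fps_X"
    for r :: real
  proof -
    have "(1 - fps_X) * ((1 - fps_const r * fps_X) oo ?p)
        = 1 - fps_X - fps_const r * fps_X * ((1 - fps_X) * inverse (1 - fps_X))"
      by (simp add: fps_compose_sub_distrib fps_compose_mult_distrib algebra_simps)
    then show ?thesis unfolding one_minus_fps_X_inverse by simp
  qed
  then show "?E e" if "\<exists>r. e = 1 - fps_const r * fps_X" using that by auto
  assume E: "?E e"
  \<comment> \<open>The coefficient of \<open>z\<close> in the equation reads
    \<open>e $ 1 - e $ 0 = e $ 1 - 1\<close>.\<close>
  from arg_cong[OF E, of "\<lambda>f. f $ 1"] have e0: "e $ 0 = 1"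
    using fps_compose_nth_1[of e ?p] by (simp add: fps_mult_nth_1)
  \<comment> \<open>With this choice the difference from \<open>1 - fps_const r * fps_X\<close> also
    loses its linear term.\<close>
  define r where "r = - e $ 1"
  have "e - (1 - fps_const r * fps_X) = 0"
  proof (rule fixed_point_eq_0)
    show "(1 - fps_X) * ((e - (1 - fps_const r * fps_X)) oo ?p) = e - (1 - fps_const r * fps_X)"
      using E lin[of r] by (simp add: fps_compose_sub_distrib[of e] right_diff_distrib[of "1 - fps_X"])
  qed (simp_all add: e0 r_def)
  then show "\<exists>r. e = 1 - fps_const r * fps_X" by auto
qed

text \<open>In a product of Bell arrays the second component is \<open>fps_X\<close> times the
  first, so commuting is one equation between first components. Taking reciprocals turns it into an
  equation affine in \<open>inverse d\<close>.\<close>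

lemma bell_commute_iff:
  fixes d :: "real fps"
  defines "q \<equiv> inverse (1 - fps_X)"
  assumes d: "d $ 0 \<noteq> 0"
  shows "(d, fps_X * d) \<otimes>\<^bsub>riordan_group\<^esub> (q, fps_X * q)
      = (q, fps_X * q) \<otimes>\<^bsub>riordan_group\<^esub> (d, fps_X * d)
    \<longleftrightarrow> (1 - fps_X) * (inverse d oo (fps_X * q)) = inverse d - fps_X"
proof -
  let ?L = "d * inverse (1 - fps_X * d)" and ?R = "q * (d oo (fps_X * q))"
  have "q oo (fps_X * d) = inverse (1 - fps_X * d)"
    by (simp add: q_def fps_inverse_compose fps_compose_sub_distrib)
  then have "(d, fps_X * d) \<otimes>\<^bsub>riordan_group\<^esub> (q, fps_X * q)
      = (q, fps_X * q) \<otimes>\<^bsub>riordan_group\<^esub> (d, fps_X * d) \<longleftrightarrow> ?L = ?R"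
    by (auto simp: riordan_mult fps_compose_mult_distrib mult.assoc)
  also have "\<dots> \<longleftrightarrow> inverse ?L = inverse ?R"
    using d by (intro fps_inverse_eq_iff[symmetric]) (simp_all add: q_def)
  also have "inverse ?L = inverse d - fps_X"
  proof -
    have "inverse ?L = inverse d * (1 - fps_X * d)"
      by (simp add: fps_inverse_mult)
    also have "\<dots> = inverse d - fps_X * (inverse d * d)"
      by (simp add: algebra_simps)
    finally show ?thesis using d by (simp add: inverse_mult_eq_1)
  qed
  also have "inverse ?R = (1 - fps_X) * (inverse d oo (fps_X * q))"
    using d by (simp add: fps_inverse_mult q_def fps_inverse_compose)
  finally show ?thesis by auto
qed

theorem theorem2p5:
  "centralizer (riordan_group\<lparr>carrier := bell_subgroup\<rparr>)
     {(1 / (1 - fps_X), fps_X / (1 - fps_X))} =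
   {(1 / (1 - fps_const r * fps_X), fps_X / (1 - fps_const r * fps_X)) | r :: real. True}"
proof -
  have div: "a / (1 - fps_const r * fps_X) = a * inverse (1 - fps_const r * fps_X)"
    for a :: "real fps" and r :: real
    by (simp add: fps_divide_unit)
  have div1: "a / (1 - fps_X) = a * inverse (1 - fps_X)" for a :: "real fps"
    by (simp add: fps_divide_unit)
  \<comment> \<open>A series with zero constant term has \<open>inverse\<close> equal to 0, so
    undoing the inversion relies on \<open>d $ 0 \<noteq> 0\<close>.\<close>
  have sol: "d $ 0 \<noteq> 0 \<and> inverse d = 1 - fps_const r * fps_X
      \<longleftrightarrow> d = inverse (1 - fps_const r * fps_X)" for d :: "real fps" and r
  proof
    assume "d $ 0 \<noteq> 0 \<and> inverse d = 1 - fps_const r * fps_X"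
    then show "d = inverse (1 - fps_const r * fps_X)"
      by (metis fps_inverse_idempotent)
  qed simp
  have "centralizer (riordan_group\<lparr>carrier := bell_subgroup\<rparr>)
      {(inverse (1 - fps_X), fps_X * inverse (1 - fps_X))}
    = {(d, fps_X * d) | d. d $ 0 \<noteq> 0 \<and> (\<exists>r. inverse d = 1 - fps_const r * fps_X)}"
    by (auto simp: centralizer_def bell_subgroup_def fps_of_order_0_iff bell_commute_iff
        reciprocal_equation_iff)
  also have "\<dots> = (\<lambda>d. (d, fps_X * d)) ` {d. \<exists>r. d = inverse (1 - fps_const r * fps_X)}"
    unfolding sol[symmetric] by blast
  also have "\<dots> = {(inverse (1 - fps_const r * fps_X), fps_X * inverse (1 - fps_const r * fps_X))
      | r. True}"
    by blast
  finally show ?thesis by (simp add: div div1)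
qed

end
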